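(* Suppose $\ker\begin{bmatrix}X_-R_-^\top\\ U_-R_-^\top\end{bmatrix}^\top=\{0\}$, and let $\sigma_{(U_-,X)}^1,\dots,\sigma_{(U_-,X)}^L\in\mathbb{R}^{n\times(n+m)}$ be the vertices of the convex polytope $\Sigma_{(U_-,X)}^R$. The data $(U_-,X)$ are informative for quadratic stabilization by state feedback if and only if there exist $Y\in\mathbb{R}^{n\times n}$ and $W\in\mathbb{R}^{m\times n}$ such that, with $Z:=\begin{bmatrix}Y\\ W\end{bmatrix}$, $$\begin{bmatrix}Y&Z^\top(\sigma_{(U_-,X)}^i)^\top\\ \sigma_{(U_-,X)}^iZ&Y\end{bmatrix}\succ0,\qquad i=1,\dots,L.$$ Moreover, for any such $Y,W$, the gain $K=WY^{-1}$ satisfies $\Sigma_{(U_-,X)}^R\subseteq\Sigma_K$.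
   Context: Let $n,m,M,N\ge 1$ be integers. State data $x(0),\dots,x(N)\in\mathbb{R}^n$ and input data $u(0),\dots,u(N-1)\in\mathbb{R}^m$ are collected in $X=[x(0)\ \cdots\ x(N)]$, $X_+=[x(1)\ \cdots\ x(N)]$, $X_-=[x(0)\ \cdots\ x(N-1)]$, $U_-=[u(0)\ \cdots\ u(N-1)]$. An instrumental signal matrix $R_-\in\mathbb{R}^{M\times N}$ and bounds $C_l,C_u\in\mathbb{R}^{n\times M}$ are given. Inequalities $\le$ between matrices are entry-wise; $\succ0$ and $\prec0$ mean symmetric positive definite and symmetric negative definite. The data are generated by a true system $(A_0,B_0)$, i.e. $X_+=A_0X_-+B_0U_-+E_-^0$ for some unknown $E_-^0\in\mathcal{E}_R:=\{E\in\mathbb{R}^{n\times N}\mid C_l\le\tfrac{1}{\sqrt N}ER_-^\top\le C_u\}$. The (hence non-empty) set of feasible systems is $$\Sigma_{(U_-,X)}^R:=\{(A,B)\in\mathbb{R}^{n\times n}\times\mathbb{R}^{n\times m}\mid \exists E_-\in\mathcal{E}_R:\ X_+=AX_-+BU_-+E_-\}.$$ A pair $(A,B)$ is identified with $[A\ \ B]\in\mathbb{R}^{n\times(n+m)}$. Under the kernel condition of the claim, $\Sigma_{(U_-,X)}^R$ is a bounded polyhedron, so it is the convex hull of its finitely many vertices $\sigma_{(U_-,X)}^1,\dots,\sigma_{(U_-,X)}^L$. A matrix is stable if all its eigenvalues are in the open unit disk; $\Sigma_K:=\{(A,B)\mid A+BK\text{ is stable}\}$. The data $(U_-,X)$ are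 informative for quadratic stabilization by state feedback if there exist $K\in\mathbb{R}^{m\times n}$ and $P\succ0$ such that $(A+BK)P(A+BK)^\top-P\prec0$ for all $(A,B)\in\Sigma_{(U_-,X)}^R$. *)

theory Defs
  imports "HOL-Analysis.Analysis"
begin

text \<open>A matrix with \<open>p\<close> rows and \<open>q\<close> columns has type \<open>real ^ 'q ^ 'p\<close>. Horizontal and
  vertical concatenation are indexed by sum types, \<open>Inl\<close> being the first block.\<close>

definition hcat :: "real ^ 'a ^ 'r \<Rightarrow> real ^ 'b ^ 'r \<Rightarrow> real ^ ('a + 'b) ^ 'r" where
  "hcat A B = (\<chi> i j. case j of Inl k \<Rightarrow> A $ i $ k | Inr k \<Rightarrow> B $ i $ k)"

definition vcat :: "real ^ 'c ^ 'a \<Rightarrow> real ^ 'c ^ 'b \<Rightarrow> real ^ 'c ^ ('a + 'b)" where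
  "vcat A B = (\<chi> i. case i of Inl k \<Rightarrow> A $ k | Inr k \<Rightarrow> B $ k)"

definition mat_ker :: "real ^ 'q ^ 'p \<Rightarrow> (real ^ 'q) set" where
  "mat_ker A = {v. A *v v = 0}"

definition pos_def :: "real ^ 'n ^ 'n \<Rightarrow> bool" where
  "pos_def A \<longleftrightarrow> transpose A = A \<and> (\<forall>v. v \<noteq> 0 \<longrightarrow> v \<bullet> (A *v v) > 0)"

definition neg_def :: "real ^ 'n ^ 'n \<Rightarrow> bool" where
  "neg_def A \<longleftrightarrow> transpose A = A \<and> (\<forall>v. v \<noteq> 0 \<longrightarrow> v \<bullet> (A *v v) < 0)"

definition eigenvalue_of :: "real ^ 'n ^ 'n \<Rightarrow> complex \<Rightarrow> bool" where
  "eigenvalue_of A z \<longleftrightarrow> (\<exists>v. v \<noteq> 0 \<and> map_matrix complex_of_real A *v v = z *s v)"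

definition stable :: "real ^ 'n ^ 'n \<Rightarrow> bool" where
  "stable A \<longleftrightarrow> (\<forall>z. eigenvalue_of A z \<longrightarrow> cmod z < 1)"

text \<open>The number of samples is the cardinality of a finite linearly ordered type \<open>'N\<close>. Its
  elements label the columns of the data matrices, and \<open>sample_time\<close> is the order isomorphism
  onto \<open>{0, ..., CARD('N) - 1}\<close>. A state trajectory is a function on \<open>nat\<close> of which only the
  values at \<open>0, ..., CARD('N)\<close> are used; an input sequence is used at
  \<open>0, ..., CARD('N) - 1\<close>.\<close>

definition sample_time :: "'N::{finite,linorder} \<Rightarrow> nat" where
  "sample_time k = card {j. j < k}"

definition past_data :: "(nat \<Rightarrow> real ^ 'a) \<Rightarrow> real ^ ('N::{finite,linorder}) ^ 'a" where
  "past_data x = (\<chi> i k. x (sample_time k) $ i)"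

definition future_data :: "(nat \<Rightarrow> real ^ 'a) \<Rightarrow> real ^ ('N::{finite,linorder}) ^ 'a" where
  "future_data x = (\<chi> i k. x (Suc (sample_time k)) $ i)"

text \<open>The order on \<open>real ^ 'M ^ 'n\<close> is entry-wise.\<close>

definition noise_set ::
  "real ^ ('N::{finite,linorder}) ^ 'M \<Rightarrow> real ^ 'M ^ 'n \<Rightarrow> real ^ 'M ^ 'n \<Rightarrow>
   (real ^ ('N::{finite,linorder}) ^ 'n) set"
  where "noise_set R Cl Cu =
    {E. Cl \<le> (1 / sqrt (real CARD('N::{finite,linorder}))) *\<^sub>R (E ** transpose R) \<and>
        (1 / sqrt (real CARD('N::{finite,linorder}))) *\<^sub>R (E ** transpose R) \<le> Cu}"

definition feasible_systems ::
  "real ^ ('N::{finite,linorder}) ^ 'M \<Rightarrow> real ^ 'M ^ 'n \<Rightarrow> real ^ 'M ^ 'n \<Rightarrow>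
   (nat \<Rightarrow> real ^ 'm) \<Rightarrow> (nat \<Rightarrow> real ^ 'n) \<Rightarrow> ((real ^ 'n ^ 'n) \<times> (real ^ 'm ^ 'n)) set"
  where "feasible_systems R Cl Cu u x =
    {(A, B). \<exists>E \<in> noise_set R Cl Cu.
       future_data x = A ** past_data x + B ** past_data u + E}"

text \<open>The same set under the identification of \<open>(A, B)\<close> with \<open>[A B]\<close>.\<close>

definition feasible_matrices ::
  "real ^ ('N::{finite,linorder}) ^ 'M \<Rightarrow> real ^ 'M ^ 'n \<Rightarrow> real ^ 'M ^ 'n \<Rightarrow>
   (nat \<Rightarrow> real ^ 'm) \<Rightarrow> (nat \<Rightarrow> real ^ 'n) \<Rightarrow> (real ^ ('n + 'm) ^ 'n) set"
  where "feasible_matrices R Cl Cu u x = (\<lambda>(A, B). hcat A B) ` feasible_systems R Cl Cu u x"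

definition stabilized_systems ::
  "real ^ 'n ^ 'm \<Rightarrow> ((real ^ 'n ^ 'n) \<times> (real ^ 'm ^ 'n)) set" where
  "stabilized_systems K = {(A, B). stable (A + B ** K)}"

definition informative_quadratic_stabilization ::
  "real ^ ('N::{finite,linorder}) ^ 'M \<Rightarrow> real ^ 'M ^ 'n \<Rightarrow> real ^ 'M ^ 'n \<Rightarrow>
   (nat \<Rightarrow> real ^ 'm) \<Rightarrow> (nat \<Rightarrow> real ^ 'n) \<Rightarrow> bool"
  where "informative_quadratic_stabilization R Cl Cu u x \<longleftrightarrow>
    (\<exists>(K :: real ^ 'n ^ 'm) (P :: real ^ 'n ^ 'n). pos_def P \<and>
       (\<forall>(A, B) \<in> feasible_systems R Cl Cu u x.
          neg_def ((A + B ** K) ** P ** transpose (A + B ** K) - P)))"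

definition vertices :: "'a::real_vector set \<Rightarrow> 'a set" where
  "vertices S = {v. v extreme_point_of S}"

definition lmi_matrix ::
  "real ^ ('n + 'm) ^ 'n \<Rightarrow> real ^ 'n ^ 'n \<Rightarrow> real ^ 'n ^ 'm \<Rightarrow> real ^ ('n + 'n) ^ ('n + 'n)" where
  "lmi_matrix \<sigma> Y W =
    (let Z = vcat Y W in
     vcat (hcat Y (transpose Z ** transpose \<sigma>))
          (hcat (\<sigma> ** Z) Y))"

end

theory Submission
  imports Defs
begin

text \<open>
  For a fixed gain \<open>K\<close> and \<open>P \<succ> 0\<close>, completing the square turns the Lyapunov inequality
  \<open>(A + B K) P (A + B K)\<^sup>T - P \<prec> 0\<close>, which is quadratic in \<open>(A, B)\<close>, into positive definiteness
  of the block matrix of the theorem with \<open>Y = P\<close> and \<open>W = K P\<close>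
  (\<open>pos_def_lmi_matrix_iff_lyapunov\<close>). In the other direction, the diagonal block \<open>Y\<close> is itself positive
  definite, hence invertible, so \<open>K = W Y\<^sup>-\<^sup>1\<close> recovers a gain from a solution \<open>Y, W\<close>.

  The block matrix is affine in \<open>[A B]\<close>, so the systems at which it is positive definite form a
  convex set. It therefore suffices to require positive definiteness at the vertices of the
  feasible set, as soon as this set is the convex hull of its vertices. That holds
  because it is a polytope: multiplying the data equation by \<open>R\<^sup>T\<close> shows that \<open>S = [A B]\<close> is
  feasible exactly when \<open>S D\<close> lies in a box, where \<open>D\<close> stacks \<open>X R\<^sup>T\<close> on \<open>U R\<^sup>T\<close>, and
  the kernel condition says that \<open>S \<mapsto> S D\<close> is injective (\<open>polytope_feasible_matrices\<close>).

  The true system makes the feasible set nonempty. Without this, the vertex condition would hold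
  vacuously for every \<open>Y\<close>, and \<open>Y \<succ> 0\<close> could not be inferred. Stability of the closed loop follows
  from the Lyapunov inequality (\<open>lyapunov_stable\<close>).
\<close>

section \<open>Block matrices\<close>

definition block_vec :: "real ^ 'a \<Rightarrow> real ^ 'b \<Rightarrow> real ^ ('a + 'b)" where
  "block_vec a b = (\<chi> i. case i of Inl k \<Rightarrow> a $ k | Inr k \<Rightarrow> b $ k)"

lemma block_vec_exhaust: obtains a b where "v = block_vec a b"
proof
  show "v = block_vec (\<chi> k. v $ Inl k) (\<chi> k. v $ Inr k)"
    by (simp add: block_vec_def vec_eq_iff split: sum.split)
qed

lemma block_vec_eq_0_iff: "block_vec a b = 0 \<longleftrightarrow> a = 0 \<and> b = 0"
  by (auto simp: block_vec_def vec_eq_iff split: sum.split)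

lemma sum_UNIV_sum_type:
  fixes f :: "'a::finite + 'b::finite \<Rightarrow> real"
  shows "(\<Sum>i\<in>UNIV. f i) = (\<Sum>k\<in>UNIV. f (Inl k)) + (\<Sum>k\<in>UNIV. f (Inr k))"
  by (simp add: UNIV_Plus_UNIV[symmetric] sum.Plus del: UNIV_Plus_UNIV)

lemma inner_block_vec: "block_vec a b \<bullet> block_vec c d = a \<bullet> c + b \<bullet> d"
  by (simp add: inner_vec_def sum_UNIV_sum_type block_vec_def)

lemma hcat_mult_block_vec: "hcat A B *v block_vec a b = A *v a + B *v b"
  by (simp add: vec_eq_iff hcat_def block_vec_def matrix_vector_mult_def sum_UNIV_sum_type)

lemma vcat_mult_vector: "vcat C D *v v = block_vec (C *v v) (D *v v)"
  by (simp add: vec_eq_iff vcat_def block_vec_def matrix_vector_mult_def split: sum.split)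

lemma hcat_mult_vcat: "hcat A B ** vcat C D = A ** C + B ** D"
  by (simp add: vec_eq_iff hcat_def vcat_def matrix_matrix_mult_def sum_UNIV_sum_type)

lemma hcat_exhaust: obtains A B where "S = hcat A B"
proof
  show "S = hcat (\<chi> i k. S $ i $ Inl k) (\<chi> i k. S $ i $ Inr k)"
    by (simp add: hcat_def vec_eq_iff split: sum.split)
qed

lemma hcat_eq_iff: "hcat A B = hcat C D \<longleftrightarrow> A = C \<and> B = D"
  by (auto simp: hcat_def vec_eq_iff split: sum.split)

lemma transpose_block_matrix:
  "transpose (vcat (hcat A B) (hcat C D)) = vcat (hcat (transpose A) (transpose C)) (hcat (transpose B) (transpose D))"
  by (simp add: vec_eq_iff transpose_def vcat_def hcat_def split: sum.split)

lemma block_matrix_eq_iff: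
  "vcat (hcat A B) (hcat C D) = vcat (hcat A' B') (hcat C' D') \<longleftrightarrow>
    A = A' \<and> B = B' \<and> C = C' \<and> D = D'"
  by (auto simp: vec_eq_iff vcat_def hcat_def split: sum.split)

lemma matrix_add_rdistrib: "(A + B) ** C = A ** C + B ** C" for A :: "real ^ 'q ^ 'p"
  by (simp add: vec_eq_iff matrix_matrix_mult_def distrib_right sum.distrib)

lemma matrix_diff_rdistrib: "(A - B) ** C = A ** C - B ** C" for A :: "real ^ 'q ^ 'p"
  by (simp add: vec_eq_iff matrix_matrix_mult_def left_diff_distrib sum_subtractf)

lemma scaleR_matrix_mult: "(c *\<^sub>R A) ** B = c *\<^sub>R (A ** B)" for A :: "real ^ 'q ^ 'p"
  by (simp add: vec_eq_iff matrix_matrix_mult_def sum_distrib_left mult.assoc)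

lemma inner_matrix_transpose:
  fixes A :: "real ^ 'q ^ 'p"
  shows "v \<bullet> (A *v w) = (transpose A *v v) \<bullet> w"
  by (simp add: dot_lmul_matrix transpose_matrix_vector)

section \<open>The linear matrix inequality\<close>

text \<open>The two off-diagonal blocks are transposes of each other and so contribute the same term
  twice. In this form it is visible that the quadratic form is affine in \<open>\<sigma>\<close>.\<close>

lemma pos_def_lmi_matrix_iff:
  "pos_def (lmi_matrix \<sigma> Y W) \<longleftrightarrow> transpose Y = Y \<and>
    (\<forall>a b. (a, b) \<noteq> (0, 0) \<longrightarrow>
      a \<bullet> (Y *v a) + 2 * (b \<bullet> ((\<sigma> ** vcat Y W) *v a)) + b \<bullet> (Y *v b) > 0)"
proof -
  have quad: "block_vec a b \<bullet> (lmi_matrix \<sigma> Y W *v block_vec a b) =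
      a \<bullet> (Y *v a) + 2 * (b \<bullet> ((\<sigma> ** vcat Y W) *v a)) + b \<bullet> (Y *v b)" for a b
  proof -
    have "a \<bullet> (transpose (\<sigma> ** vcat Y W) *v b) = b \<bullet> ((\<sigma> ** vcat Y W) *v a)"
      by (simp add: inner_matrix_transpose inner_commute)
    then show ?thesis
      by (simp add: lmi_matrix_def Let_def vcat_mult_vector inner_block_vec hcat_mult_block_vec
          inner_add_right matrix_transpose_mul)
  qed
  have "transpose (lmi_matrix \<sigma> Y W) = lmi_matrix \<sigma> Y W \<longleftrightarrow> transpose Y = Y"
    by (auto simp: lmi_matrix_def Let_def transpose_block_matrix block_matrix_eq_iff
        matrix_transpose_mul)
  moreover have "(\<forall>v. v \<noteq> 0 \<longrightarrow> v \<bullet> (lmi_matrix \<sigma> Y W *v v) > 0) \<longleftrightarrow>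
    (\<forall>a b. (a, b) \<noteq> (0, 0) \<longrightarrow> block_vec a b \<bullet> (lmi_matrix \<sigma> Y W *v block_vec a b) > 0)"
    by (metis block_vec_exhaust block_vec_eq_0_iff prod.inject)
  ultimately show ?thesis
    unfolding pos_def_def quad by blast
qed

lemma convex_lmi_matrix_pos_def: "convex {\<sigma>. pos_def (lmi_matrix \<sigma> Y W)}"
proof (rule convexI, unfold mem_Collect_eq pos_def_lmi_matrix_iff, intro conjI allI impI)
  fix \<sigma> \<tau> and s t :: real and a b
  let ?q = "\<lambda>\<sigma>. a \<bullet> (Y *v a) + 2 * (b \<bullet> ((\<sigma> ** vcat Y W) *v a)) + b \<bullet> (Y *v b)"
  assume \<sigma>: "transpose Y = Y \<and> (\<forall>a b. (a, b) \<noteq> (0, 0) \<longrightarrow>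
      a \<bullet> (Y *v a) + 2 * (b \<bullet> ((\<sigma> ** vcat Y W) *v a)) + b \<bullet> (Y *v b) > 0)"
    and \<tau>: "transpose Y = Y \<and> (\<forall>a b. (a, b) \<noteq> (0, 0) \<longrightarrow>
      a \<bullet> (Y *v a) + 2 * (b \<bullet> ((\<tau> ** vcat Y W) *v a)) + b \<bullet> (Y *v b) > 0)"
    and st: "0 \<le> s" "0 \<le> t" "s + t = 1"
  show "transpose Y = Y" using \<sigma> by blast
  assume "(a, b) \<noteq> (0, 0)"
  then have pos: "?q \<sigma> > 0" "?q \<tau> > 0" using \<sigma> \<tau> by blast+
  have "?q (s *\<^sub>R \<sigma> + t *\<^sub>R \<tau>) = s * ?q \<sigma> + t * ?q \<tau>"
  proof -
    have "(s *\<^sub>R \<sigma> + t *\<^sub>R \<tau>) ** vcat Y W = s *\<^sub>R (\<sigma> ** vcat Y W) + t *\<^sub>R (\<tau> ** vcat Y W)"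
      by (simp add: matrix_add_rdistrib scaleR_matrix_mult)
    then have lin: "b \<bullet> (((s *\<^sub>R \<sigma> + t *\<^sub>R \<tau>) ** vcat Y W) *v a) =
        s * (b \<bullet> ((\<sigma> ** vcat Y W) *v a)) + t * (b \<bullet> ((\<tau> ** vcat Y W) *v a))"
      by (simp add: matrix_vector_mult_add_rdistrib scaleR_matrix_vector_assoc[symmetric]
          inner_add_right)
    have "s * c + t * c = c" for c :: real
      by (metis st(3) distrib_right mult_1)
    from this[of "a \<bullet> (Y *v a)"] this[of "b \<bullet> (Y *v b)"] show ?thesis
      unfolding lin by (simp add: distrib_left mult.left_commute)
  qed
  moreover have "s * ?q \<sigma> + t * ?q \<tau> > 0"
    using pos st by (cases "s = 0") (auto intro!: add_pos_nonneg)
  ultimately show "?q (s *\<^sub>R \<sigma> + t *\<^sub>R \<tau>) > 0" by simp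
qed

text \<open>A polytope is the convex hull of its vertices, and hence lies in every convex set that
  contains them.\<close>

lemma lmi_on_polytope_iff_lmi_on_vertices:
  assumes "polytope S"
  shows "(\<forall>\<sigma>\<in>vertices S. pos_def (lmi_matrix \<sigma> Y W)) \<longleftrightarrow> (\<forall>\<sigma>\<in>S. pos_def (lmi_matrix \<sigma> Y W))"
proof
  assume vert: "\<forall>\<sigma>\<in>vertices S. pos_def (lmi_matrix \<sigma> Y W)"
  have "S = convex hull (vertices S)"
    unfolding vertices_def
    by (rule Krein_Milman_Minkowski) (simp_all add: assms polytope_imp_compact polytope_imp_convex)
  also have "\<dots> \<subseteq> {\<sigma>. pos_def (lmi_matrix \<sigma> Y W)}"
    using vert by (intro hull_minimal convex_lmi_matrix_pos_def) auto
  finally show "\<forall>\<sigma>\<in>S. pos_def (lmi_matrix \<sigma> Y W)" by blast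
qed (auto simp: vertices_def extreme_point_of_def)

text \<open>A Schur complement argument. With \<open>F = A + B K\<close>, the off-diagonal block is \<open>F P\<close>, and
  completing the square in the first block component \<open>a\<close> splits the quadratic form into the form of \<open>P\<close> at
  \<open>a + F\<^sup>T b\<close> minus the form of \<open>F P F\<^sup>T - P\<close> at \<open>b\<close>.\<close>

lemma pos_def_lmi_matrix_iff_lyapunov:
  fixes A :: "real ^ 'n ^ 'n" and B :: "real ^ 'm ^ 'n" and K :: "real ^ 'n ^ 'm"
  shows "pos_def (lmi_matrix (hcat A B) P (K ** P)) \<longleftrightarrow>
    pos_def P \<and> neg_def ((A + B ** K) ** P ** transpose (A + B ** K) - P)"
proof (cases "transpose P = P")
  case False
  then show ?thesis unfolding pos_def_lmi_matrix_iff by (simp add: pos_def_def)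
next
  case sym: True
  define F where "F = A + B ** K"
  let ?G = "F ** P ** transpose F - P"
  have closed_loop: "hcat A B ** vcat P (K ** P) = F ** P"
    by (simp add: hcat_mult_vcat F_def matrix_add_rdistrib matrix_mul_assoc)
  have adj: "v \<bullet> (P *v w) = (P *v v) \<bullet> w" for v w
    by (simp add: inner_matrix_transpose sym)
  have schur: "a \<bullet> (P *v a) + 2 * (b \<bullet> ((F ** P) *v a)) + b \<bullet> (P *v b) =
      (a + transpose F *v b) \<bullet> (P *v (a + transpose F *v b)) - b \<bullet> (?G *v b)" for a b
  proof -
    have 1: "b \<bullet> ((F ** P) *v a) = (transpose F *v b) \<bullet> (P *v a)"
      by (simp add: inner_matrix_transpose matrix_vector_mul_assoc[symmetric])
    have 2: "b \<bullet> (?G *v b) = (transpose F *v b) \<bullet> (P *v (transpose F *v b)) - b \<bullet> (P *v b)"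
      by (simp add: matrix_vector_mult_diff_rdistrib inner_diff_right
          matrix_vector_mul_assoc[symmetric] inner_matrix_transpose[of b F])
    have 3: "a \<bullet> (P *v (transpose F *v b)) = (transpose F *v b) \<bullet> (P *v a)"
      by (metis adj inner_commute)
    show ?thesis
      unfolding 1 2 by (simp add: inner_add_left inner_add_right matrix_vector_right_distrib 3
          del: transpose_matrix_vector)
  qed
  have symG: "transpose ?G = ?G"
  proof -
    have "transpose (F ** P ** transpose F) = F ** P ** transpose F"
      by (simp add: matrix_transpose_mul matrix_mul_assoc sym)
    moreover have "transpose (A - C) = transpose A - transpose C" for A C :: "real ^ 'n ^ 'n"
      by (simp add: transpose_def vec_eq_iff)
    ultimately show ?thesis by (simp only: sym)
  qed
  show ?thesis
  proof
    assume "pos_def (lmi_matrix (hcat A B) P (K ** P))"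
    then have pos: "(a, b) \<noteq> (0, 0) \<Longrightarrow>
        a \<bullet> (P *v a) + 2 * (b \<bullet> ((F ** P) *v a)) + b \<bullet> (P *v b) > 0" for a b
      unfolding pos_def_lmi_matrix_iff closed_loop by blast
    have "v \<bullet> (P *v v) > 0" if "v \<noteq> 0" for v
      using pos[of v 0] that by simp
    \<comment> \<open>The choice of the first component makes the square vanish.\<close>
    moreover have "v \<bullet> (?G *v v) < 0" if "v \<noteq> 0" for v
      using pos[of "- (transpose F *v v)" v] that by (simp only: schur) simp
    ultimately show "pos_def P \<and> neg_def ((A + B ** K) ** P ** transpose (A + B ** K) - P)"
      using sym symG by (simp add: pos_def_def neg_def_def F_def)
  next
    assume "pos_def P \<and> neg_def ((A + B ** K) ** P ** transpose (A + B ** K) - P)"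
    then have P: "v \<noteq> 0 \<Longrightarrow> v \<bullet> (P *v v) > 0" and G: "v \<noteq> 0 \<Longrightarrow> v \<bullet> (?G *v v) < 0" for v
      by (auto simp: pos_def_def neg_def_def F_def)
    have P0: "v \<bullet> (P *v v) \<ge> 0" for v
      using P[of v] by (cases "v = 0") auto
    have "a \<bullet> (P *v a) + 2 * (b \<bullet> ((F ** P) *v a)) + b \<bullet> (P *v b) > 0"
      if "(a, b) \<noteq> (0, 0)" for a b
    proof (cases "b = 0")
      case True
      then show ?thesis using that P[of a] by simp
    next
      case False
      then show ?thesis
        unfolding schur using G[of b] P0[of "a + transpose F *v b"] by linarith
    qed
    then show "pos_def (lmi_matrix (hcat A B) P (K ** P))"
      unfolding pos_def_lmi_matrix_iff closed_loop using sym by blast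
  qed
qed

lemma pos_def_imp_invertible:
  assumes "pos_def P" shows "invertible P"
proof -
  have "v = 0" if "P *v v = 0" for v
    using assms that unfolding pos_def_def by (metis inner_zero_right less_irrefl)
  then show ?thesis
    by (metis invertible_left_inverse matrix_left_invertible_ker)
qed

lemma matrix_inv_cancel_right:
  fixes P :: "real ^ 'n ^ 'n"
  assumes "invertible P" shows "W ** matrix_inv P ** P = W"
proof -
  have "matrix_inv P ** P = mat 1"
    using someI_ex[OF assms[unfolded invertible_def]] unfolding matrix_inv_def by blast
  then show ?thesis by (simp add: matrix_mul_assoc[symmetric])
qed

section \<open>Stability from the Lyapunov inequality\<close>

text \<open>Over the complex numbers, \<open>z\<close> is an eigenvalue exactly when \<open>A - z I\<close> has zero determinant,
  a condition invariant under transposition.\<close>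

lemma eigenvalue_of_transpose:
  assumes "eigenvalue_of A z" shows "eigenvalue_of (transpose A) z"
proof -
  let ?c = "map_matrix complex_of_real"
  have singular: "eigenvalue_of C z \<longleftrightarrow> det (?c C - mat z) = 0" for C :: "real ^ 'n ^ 'n"
  proof -
    have "mat z *v v = z *s v" for v :: "complex ^ 'n"
      by (simp add: vec_eq_iff matrix_vector_mult_def mat_def if_distrib[of "\<lambda>x. x * _"] cong: if_cong)
    then have "eigenvalue_of C z \<longleftrightarrow> (\<exists>v. v \<noteq> 0 \<and> (?c C - mat z) *v v = 0)"
      by (simp add: eigenvalue_of_def matrix_vector_mult_diff_rdistrib)
    also have "\<dots> \<longleftrightarrow> \<not> invertible (?c C - mat z)"
      unfolding invertible_left_inverse matrix_left_invertible_ker by blast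
    finally show ?thesis by (simp add: invertible_det_nz)
  qed
  have "?c (transpose A) - mat z = transpose (?c A - mat z)"
    by (auto simp: vec_eq_iff transpose_def mat_def)
  then show ?thesis
    using assms by (simp add: singular det_transpose)
qed

text \<open>The inequality says that \<open>F\<^sup>T\<close> strictly decreases the squared norm defined by \<open>P\<close> off zero, so it
  speaks about left eigenvectors of \<open>F\<close>. If \<open>w = p + i q\<close> is an eigenvector of \<open>F\<^sup>T\<close> for \<open>z\<close>, then the sum of
  the squared \<open>P\<close>-norms of \<open>p\<close> and \<open>q\<close> (the Hermitian squared norm of \<open>w\<close>) is multiplied by
  exactly \<open>\<bar>z\<bar>\<^sup>2\<close> under \<open>F\<^sup>T\<close>. Splitting \<open>w\<close> in this way keeps the computation real.\<close>

lemma lyapunov_stable: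
  assumes P: "pos_def P" and dec: "neg_def (F ** P ** transpose F - P)"
  shows "stable F"
  unfolding stable_def
proof (intro allI impI)
  fix z assume "eigenvalue_of F z"
  then have "eigenvalue_of (transpose F) z" by (rule eigenvalue_of_transpose)
  then obtain w where w: "w \<noteq> 0" "map_matrix complex_of_real (transpose F) *v w = z *s w"
    unfolding eigenvalue_of_def by blast
  define p where "p = (\<chi> i. Re (w $ i))"
  define q where "q = (\<chi> i. Im (w $ i))"
  have wi: "(\<Sum>j\<in>UNIV. complex_of_real (transpose F $ i $ j) * w $ j) = z * w $ i" for i
    using w(2) by (simp add: vec_eq_iff matrix_vector_mult_def)
  have Fp: "transpose F *v p = Re z *\<^sub>R p - Im z *\<^sub>R q"
    using arg_cong[OF wi, of Re] by (simp add: vec_eq_iff matrix_vector_mult_def p_def q_def)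
  have Fq: "transpose F *v q = Re z *\<^sub>R q + Im z *\<^sub>R p"
    using arg_cong[OF wi, of Im] by (simp add: vec_eq_iff matrix_vector_mult_def p_def q_def)
  have nz: "p \<noteq> 0 \<or> q \<noteq> 0"
    using w(1) by (auto simp: vec_eq_iff p_def q_def complex_eq_iff)
  let ?f = "\<lambda>v. v \<bullet> (P *v v)"
  have contr: "?f (transpose F *v v) \<le> ?f v" "v \<noteq> 0 \<Longrightarrow> ?f (transpose F *v v) < ?f v" for v
  proof -
    have *: "v \<bullet> ((F ** P ** transpose F - P) *v v) = ?f (transpose F *v v) - ?f v"
      by (simp add: matrix_vector_mult_diff_rdistrib inner_diff_right
          matrix_vector_mul_assoc[symmetric] inner_matrix_transpose[of v F])
    show "v \<noteq> 0 \<Longrightarrow> ?f (transpose F *v v) < ?f v"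
      using dec *[symmetric] unfolding neg_def_def by (metis diff_less_0_iff_less)
    then show "?f (transpose F *v v) \<le> ?f v"
      by (cases "v = 0") auto
  qed
  have f_pos: "v \<noteq> 0 \<Longrightarrow> ?f v > 0" and f_nn: "?f v \<ge> 0" for v
    using P unfolding pos_def_def by (auto, cases "v = 0") (auto simp: less_imp_le)
  \<comment> \<open>The mixed terms in \<open>p\<close> and \<open>q\<close> cancel in the sum.\<close>
  have "(cmod z)\<^sup>2 * (?f p + ?f q) = ?f (transpose F *v p) + ?f (transpose F *v q)"
    unfolding Fp Fq cmod_power2
    by (simp add: matrix_vector_mult_diff_distrib matrix_vector_right_distrib
        matrix_vector_mult_scaleR inner_add_left inner_add_right inner_diff_left inner_diff_right
        power2_eq_square algebra_simps)
  also have "\<dots> < ?f p + ?f q"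
    using nz contr by (meson add_le_less_mono add_less_le_mono)
  finally have "(cmod z)\<^sup>2 * (?f p + ?f q) < 1 * (?f p + ?f q)" by simp
  moreover have "?f p + ?f q > 0"
    using nz f_pos f_nn by (meson add_nonneg_pos add_pos_nonneg)
  ultimately have "(cmod z)\<^sup>2 < 1\<^sup>2" by simp
  then show "cmod z < 1" by (rule power2_less_imp_less) simp
qed

section \<open>The feasible set is a polytope\<close>

text \<open>The part of the box met by the range of \<open>f\<close> is a polytope, and a linear left inverse
  of \<open>f\<close> maps it onto the preimage. This yields boundedness and finitely many facets at once.\<close>

lemma polytope_vimage_cbox:
  fixes f :: "'a::euclidean_space \<Rightarrow> 'b::euclidean_space"
  assumes "linear f" "inj f"
  shows "polytope (f -` cbox a b)"
proof -
  obtain g where g: "linear g" "g \<circ> f = id"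
    using linear_injective_left_inverse[OF assms] by blast
  have "f -` cbox a b = g ` (cbox a b \<inter> range f)"
    by (simp only: image_vimage_eq[symmetric] image_comp g(2) image_id) simp
  moreover have "polytope (cbox a b \<inter> range f)"
    using linear_subspace_image[OF assms(1) subspace_UNIV]
    by (simp add: polytope_Int_polyhedron polytope_interval subspace_imp_affine
        affine_imp_polyhedron)
  ultimately show ?thesis
    by (simp add: polytope_linear_image g(1))
qed

text \<open>The rows of \<open>S D\<close> are the images of the rows of \<open>S\<close> under \<open>D\<^sup>T\<close>.\<close>

lemma inj_matrix_mult_right:
  fixes D :: "real ^ 'q ^ 'p"
  assumes "mat_ker (transpose D) = {0}"
  shows "inj (\<lambda>S :: real ^ 'p ^ 'r. S ** D)"
proof (rule injI)
  fix S T :: "real ^ 'p ^ 'r"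
  assume eq: "S ** D = T ** D"
  have "transpose D *v (S $ i - T $ i) = 0" for i
  proof -
    have "(S ** D) $ i = (T ** D) $ i" using eq by simp
    then show ?thesis
      by (simp add: vec_eq_iff matrix_matrix_mult_def matrix_vector_mult_def transpose_def
          right_diff_distrib sum_subtractf mult.commute)
  qed
  then have "S $ i - T $ i = 0" for i
    using assms unfolding mat_ker_def by blast
  then show "S = T" by (simp add: vec_eq_iff)
qed

text \<open>The noise matrix is determined by the system as the residual of the data equation, so the
  existential quantifier disappears and the noise bounds become bounds on \<open>S D\<close>. The residual
  depends on \<open>S\<close> with a negative sign, which is why \<open>Cu\<close> gives the lower corner of the box.\<close>

lemma feasible_matrices_eq:
  fixes x :: "nat \<Rightarrow> real ^ 'n" and u :: "nat \<Rightarrow> real ^ 'm"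
    and R :: "real ^ ('N::{finite,linorder}) ^ 'M" and Cl Cu :: "real ^ 'M ^ 'n"
  defines "c \<equiv> 1 / sqrt (real CARD('N))"
  shows "feasible_matrices R Cl Cu u x =
    (\<lambda>S. S ** vcat (past_data x ** transpose R) (past_data u ** transpose R)) -`
      cbox (future_data x ** transpose R - (1 / c) *\<^sub>R Cu)
           (future_data x ** transpose R - (1 / c) *\<^sub>R Cl)" (is "_ = ?rhs")
proof -
  have c: "c > 0" by (simp add: c_def)
  have feas: "(A, B) \<in> feasible_systems R Cl Cu u x \<longleftrightarrow> hcat A B \<in> ?rhs" for A B
  proof -
    let ?D = "A ** (past_data x ** transpose R) + B ** (past_data u ** transpose R)"
    let ?E = "future_data x - (A ** past_data x + B ** past_data u)"
    have E: "?E ** transpose R = future_data x ** transpose R - ?D"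
      by (simp add: matrix_diff_rdistrib matrix_add_rdistrib matrix_mul_assoc)
    have "(A, B) \<in> feasible_systems R Cl Cu u x \<longleftrightarrow> ?E \<in> noise_set R Cl Cu"
      unfolding feasible_systems_def by (auto simp: add.commute intro!: bexI[of _ ?E])
    also have "\<dots> \<longleftrightarrow> hcat A B \<in> ?rhs"
      unfolding noise_set_def mem_Collect_eq c_def[symmetric] E hcat_mult_vcat vimage_eq
        interval_cbox[symmetric] atLeastAtMost_iff
      using c by (auto simp: less_eq_vec_def field_simps)
    finally show ?thesis .
  qed
  show ?thesis
  proof (intro set_eqI)
    fix S :: "real ^ ('n + 'm) ^ 'n"
    obtain A B where S: "S = hcat A B" by (rule hcat_exhaust)
    show "S \<in> feasible_matrices R Cl Cu u x \<longleftrightarrow> S \<in> ?rhs"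
      unfolding S feas[symmetric] feasible_matrices_def by (auto simp: hcat_eq_iff)
  qed
qed

lemma polytope_feasible_matrices:
  assumes "mat_ker (transpose (vcat (past_data x ** transpose R) (past_data u ** transpose R))) = {0}"
  shows "polytope (feasible_matrices R Cl Cu u x)"
proof -
  let ?D = "vcat (past_data x ** transpose R) (past_data u ** transpose R)"
  have "linear (\<lambda>S. S ** ?D)"
    by (rule linearI) (simp_all add: matrix_add_rdistrib scaleR_matrix_mult)
  then show ?thesis
    unfolding feasible_matrices_eq
    by (rule polytope_vimage_cbox) (rule inj_matrix_mult_right[OF assms])
qed

section \<open>Vertex criterion for quadratic stabilization\<close>

theorem corollary13:
  fixes x :: "nat \<Rightarrow> real ^ 'n"
    and u :: "nat \<Rightarrow> real ^ 'm"
    and R :: "real ^ ('N::{finite,linorder}) ^ 'M"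
    and Cl Cu :: "real ^ 'M ^ 'n"
    and A\<^sub>0 :: "real ^ 'n ^ 'n"
    and B\<^sub>0 :: "real ^ 'm ^ 'n"
    and E\<^sub>0 :: "real ^ ('N::{finite,linorder}) ^ 'n"
  assumes noise: "E\<^sub>0 \<in> noise_set R Cl Cu"
    and data: "future_data x = A\<^sub>0 ** past_data x + B\<^sub>0 ** past_data u + E\<^sub>0"
    and ker: "mat_ker (transpose (vcat (past_data x ** transpose R) (past_data u ** transpose R))) = {0}"
  shows "polytope (feasible_matrices R Cl Cu u x) \<and>
    (informative_quadratic_stabilization R Cl Cu u x \<longleftrightarrow>
       (\<exists>(Y :: real ^ 'n ^ 'n) (W :: real ^ 'n ^ 'm).
          \<forall>\<sigma> \<in> vertices (feasible_matrices R Cl Cu u x). pos_def (lmi_matrix \<sigma> Y W))) \<and>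
    (\<forall>(Y :: real ^ 'n ^ 'n) (W :: real ^ 'n ^ 'm).
       (\<forall>\<sigma> \<in> vertices (feasible_matrices R Cl Cu u x). pos_def (lmi_matrix \<sigma> Y W)) \<longrightarrow>
       feasible_systems R Cl Cu u x \<subseteq> stabilized_systems (W ** matrix_inv Y))"
proof -
  let ?\<Sigma> = "feasible_systems R Cl Cu u x"
  let ?S = "feasible_matrices R Cl Cu u x"
  let ?lyap = "\<lambda>A B K P. neg_def ((A + B ** K) ** P ** transpose (A + B ** K) - P)"
  have poly: "polytope ?S" by (rule polytope_feasible_matrices[OF ker])
  have vertices_iff: "(\<forall>\<sigma> \<in> vertices ?S. pos_def (lmi_matrix \<sigma> Y W)) \<longleftrightarrow>
      (\<forall>(A, B) \<in> ?\<Sigma>. pos_def (lmi_matrix (hcat A B) Y W))" for Y :: "real ^ 'n ^ 'n" and W :: "real ^ 'n ^ 'm"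
    unfolding lmi_on_polytope_iff_lmi_on_vertices[OF poly] by (auto simp: feasible_matrices_def)
  have true_system: "(A\<^sub>0, B\<^sub>0) \<in> ?\<Sigma>"
    using noise data by (auto simp: feasible_systems_def)
  have gain: "pos_def Y \<and> (\<forall>(A, B) \<in> ?\<Sigma>. ?lyap A B (W ** matrix_inv Y) Y)"
    if lmi: "\<forall>\<sigma> \<in> vertices ?S. pos_def (lmi_matrix \<sigma> Y W)"
    for Y :: "real ^ 'n ^ 'n" and W :: "real ^ 'n ^ 'm"
  proof -
    have lmi': "pos_def (lmi_matrix (hcat A B) Y W)" if "(A, B) \<in> ?\<Sigma>" for A B
      using lmi that unfolding vertices_iff by blast
    have "v \<bullet> (Y *v v) > 0" if "v \<noteq> 0" for v
      using lmi'[OF true_system] that unfolding pos_def_lmi_matrix_iff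
      by (elim conjE allE[of _ v] allE[of _ 0]) simp
    then have Y: "pos_def Y"
      using lmi'[OF true_system] unfolding pos_def_lmi_matrix_iff by (simp add: pos_def_def)
    have "W = (W ** matrix_inv Y) ** Y"
      by (simp add: matrix_inv_cancel_right pos_def_imp_invertible Y)
    then show ?thesis
      using Y lmi' pos_def_lmi_matrix_iff_lyapunov[of _ _ Y "W ** matrix_inv Y"] by auto
  qed
  have "informative_quadratic_stabilization R Cl Cu u x \<longleftrightarrow>
       (\<exists>(Y :: real ^ 'n ^ 'n) (W :: real ^ 'n ^ 'm).
          \<forall>\<sigma> \<in> vertices ?S. pos_def (lmi_matrix \<sigma> Y W))"
  proof
    assume "informative_quadratic_stabilization R Cl Cu u x"
    then obtain K P where "pos_def P" "\<forall>(A, B) \<in> ?\<Sigma>. ?lyap A B K P"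
      unfolding informative_quadratic_stabilization_def by blast
    then have "\<forall>\<sigma> \<in> vertices ?S. pos_def (lmi_matrix \<sigma> P (K ** P))"
      unfolding vertices_iff pos_def_lmi_matrix_iff_lyapunov by auto
    then show "\<exists>(Y :: real ^ 'n ^ 'n) (W :: real ^ 'n ^ 'm).
          \<forall>\<sigma> \<in> vertices ?S. pos_def (lmi_matrix \<sigma> Y W)" by blast
  next
    assume "\<exists>(Y :: real ^ 'n ^ 'n) (W :: real ^ 'n ^ 'm).
          \<forall>\<sigma> \<in> vertices ?S. pos_def (lmi_matrix \<sigma> Y W)"
    then show "informative_quadratic_stabilization R Cl Cu u x"
      unfolding informative_quadratic_stabilization_def using gain by blast
  qed
  moreover have "?\<Sigma> \<subseteq> stabilized_systems (W ** matrix_inv Y)"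
    if "\<forall>\<sigma> \<in> vertices ?S. pos_def (lmi_matrix \<sigma> Y W)"
    for Y :: "real ^ 'n ^ 'n" and W :: "real ^ 'n ^ 'm"
    using gain[OF that] by (auto simp: stabilized_systems_def intro: lyapunov_stable)
  ultimately show ?thesis using poly by blast
qed

end
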